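(* For all integers $s\ge t\ge 2$ and $k\ge 1$, there exists a triangle-free graph $G$ with chromatic number $\chi(G)>k$ such that every $K_{s,t}$-free subgraph of $G$ is $(t+1)$-colourable.
   Context: All graphs are finite and simple. Subgraphs are not necessarily induced. $K_{s,t}$ is the complete bipartite graph with one part of size $s$ and the other part of size $t$. A graph is $H$-free if it contains no (not necessarily induced) subgraph isomorphic to $H$. A graph is $k$-colourable if its vertices can be assigned $k$ colours so that adjacent vertices receive different colours; $\chi(G)$ is the least $k$ such that $G$ is $k$-colourable. *)

theory Defs
  imports "Graph_Theory.Graph_Theory"
begin

text \<open>
  A finite simple graph is a \<^locale>\<open>pair_graph\<close>, i.e. a finite symmetric loop-free set of arcs
  without parallel arcs. \<^const>\<open>subgraph\<close> does not require the subgraph to be symmetric, so where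
  subgraphs of graphs are meant, the subgraph must be required separately to be a graph.

  In the next definition, \<open>P\<close> is the isomorphism class of the forbidden graph, such as
  \<^const>\<open>complete_digraph\<close> or \<^const>\<open>complete_bipartite_digraph\<close> with their parameters
  (both of which only hold of symmetric digraphs).
\<close>

definition free_of :: "(('a,'b) pre_digraph \<Rightarrow> bool) \<Rightarrow> ('a,'b) pre_digraph \<Rightarrow> bool" where
  "free_of P G \<longleftrightarrow> \<not> (\<exists>L. subgraph L G \<and> P L)"

abbreviation triangle_free :: "('a,'b) pre_digraph \<Rightarrow> bool" where
  "triangle_free G \<equiv> free_of (complete_digraph 3) G"

definition colourable :: "nat \<Rightarrow> ('a,'b) pre_digraph \<Rightarrow> bool" where
  "colourable k G \<longleftrightarrow>
     (\<exists>c :: 'a \<Rightarrow> nat. c ` verts G \<subseteq> {..<k} \<and> (\<forall>(u, v) \<in> arcs_ends G. c u \<noteq> c v))"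

text \<open>Meaningful for finite loop-free digraphs, where the minimum exists.\<close>

definition chromatic_number :: "('a,'b) pre_digraph \<Rightarrow> nat" where
  "chromatic_number G = (LEAST k. colourable k G)"

lemma colourable_mono: "colourable k G \<Longrightarrow> k \<le> l \<Longrightarrow> colourable l G"
  unfolding colourable_def by (metis lessThan_subset_iff subset_trans)

lemma (in digraph) colourable_card_verts: "colourable (card (verts G)) G"
proof -
  obtain c :: "'a \<Rightarrow> nat" where c: "bij_betw c (verts G) {0..<card (verts G)}"
    using ex_bij_betw_finite_nat[OF finite_verts] by blast
  have ne: "c u \<noteq> c v" if "(u, v) \<in> arcs_ends G" for u v
    using that c adj_not_same[of u]
    by (metis adj_in_verts(1) adj_in_verts(2) bij_betw_inv_into_left)
  show ?thesis
    unfolding colourable_def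
    by (rule exI[of _ c]) (use c ne in \<open>auto simp: bij_betw_def lessThan_atLeast0\<close>)
qed

lemma (in digraph) chromatic_number_le_iff: "chromatic_number G \<le> k \<longleftrightarrow> colourable k G"
  unfolding chromatic_number_def
  by (meson LeastI Least_le colourable_card_verts colourable_mono)

end

theory Submission
  imports Defs "HOL-Library.Z2" "HOL-Library.Multiset" "HOL-Library.Sublist"
begin

text \<open>
  The graph is the arc graph (line digraph) of a suitable acyclic digraph \<open>D\<close>. Its vertices are the arcs
  of \<open>D\<close>, and \<open>(a, b)\<close> is adjacent to \<open>(b, c)\<close>. Such a graph is triangle-free, and its chromatic number
  is more than \<open>k\<close> if \<open>D\<close> cannot be coloured with \<open>2 ^ k\<close> colours.

  Suppose that all indegrees of \<open>D\<close> are at most \<open>K\<close>, and let \<open>H\<close> be a subgraph of the arc graph without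
  \<open>K\<^bsub>s,t\<^esub>\<close>. At each vertex \<open>b\<close> of \<open>D\<close>, only a bounded number of arcs out of \<open>b\<close> can have \<open>t\<close> or more
  neighbours in \<open>H\<close> among the few arcs into \<open>b\<close>; the bound \<open>M\<close> depends on \<open>s\<close> and \<open>K\<close> only. If the
  subdigraph of these exceptional arcs is 3-colourable, then \<open>H\<close> is \<open>(t + 1)\<close>-colourable by a greedy
  argument (\<open>colourable_if_biclique_free\<close>). What is needed is therefore a digraph of large
  chromatic number and bounded indegrees in which all subdigraphs of outdegree at most \<open>M\<close> are
  3-colourable, where \<open>M\<close> may be arbitrarily large compared with the bound on the indegrees.

  Iterated generalised Mycielskians have this property, if the arcs at each apex are directed away from it
  and if the parameters are chosen from the last step to the first: there are many levels compared with
  \<open>M\<close>, and the digraph below the levels is good for a much larger bound. A subdigraph with small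
  outdegrees uses only a few arcs at each apex, and it then looks like a subdigraph of the digraph below
  the levels, up to a small disturbance near the apex that can be absorbed within the levels
  (\<open>sparse_3colourable_myc\<close>).

  The chromatic number of iterated generalised Mycielskians is bounded from below by the topological method.
  Each step suspends the sphere that is contained in the box complex (\<open>has_sphere_myc\<close>), and a colouring
  with too few colours would contradict the Borsuk-Ulam theorem. The latter enters in the combinatorial
  form due to Ky Fan: the parity of the number of alternating simplices is the same in all dimensions
  (\<open>has_sphere_colours\<close>).
\<close>

section \<open>Chains and coboundaries modulo 2\<close>

text \<open>
  Parities are computed in the field \<^typ>\<open>bit\<close>, where sums should stay sums instead of being
  rewritten to exclusive disjunctions.
\<close>

declare add_bit_eq_xor [simp del]

lemma bit_double [simp]: "x + x = (0::bit)"
  by (cases x) (simp_all add: add_bit_eq_xor)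

lemma bit_double_left [simp]: "x + (x + y) = (y::bit)"
  by (simp add: add.assoc [symmetric])

lemma bit_transpose: "x + y = z \<Longrightarrow> x = y + (z::bit)"
  by (metis add.commute bit_double_left)

text \<open>
  Simplices are lists of vertices, repetitions allowed, so that the prism operator below is available
  without choosing an order of the vertices. For a function \<open>\<phi>\<close> on simplices, \<open>coboundary \<phi> l\<close> sums
  \<open>\<phi>\<close> over the lists that arise from \<open>l\<close> by deleting one position. Chains are lists of simplices; they
  are never compared directly, but only through their totals \<open>total \<phi> c\<close>, for all \<open>\<phi>\<close> at once.
\<close>

primrec coboundary :: "('a list \<Rightarrow> bit) \<Rightarrow> 'a list \<Rightarrow> bit" where
  "coboundary \<phi> [] = 0"
| "coboundary \<phi> (x # l) = \<phi> l + coboundary (\<lambda>m. \<phi> (x # m)) l"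

abbreviation total :: "('a \<Rightarrow> bit) \<Rightarrow> 'a list \<Rightarrow> bit" where
  "total \<phi> c \<equiv> sum_list (map \<phi> c)"

lemma coboundary_add: "coboundary (\<lambda>l. \<phi> l + \<psi> l) l = coboundary \<phi> l + coboundary \<psi> l"
  by (induction l arbitrary: \<phi> \<psi>) (simp_all add: ac_simps)

lemma coboundary_zero: "coboundary (\<lambda>l. 0) l = 0"
  by (induction l) simp_all

lemma total_add: "total (\<lambda>l. \<phi> l + \<psi> l) c = total \<phi> c + total \<psi> c"
  by (induction c) (simp_all add: ac_simps)

lemma total_map: "total \<phi> (map h c) = total (\<lambda>x. \<phi> (h x)) c"
  by (simp add: o_def)

lemma coboundary_map: "coboundary \<phi> (map f l) = coboundary (\<lambda>m. \<phi> (map f m)) l"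
  by (induction l arbitrary: \<phi>) simp_all

lemma coboundary_cong: "(\<And>m. subseq m l \<Longrightarrow> \<phi> m = \<psi> m) \<Longrightarrow> coboundary \<phi> l = coboundary \<psi> l"
proof (induction l arbitrary: \<phi> \<psi>)
  case (Cons x l)
  have "coboundary (\<lambda>m. \<phi> (x # m)) l = coboundary (\<lambda>m. \<psi> (x # m)) l"
    by (rule Cons.IH) (rule Cons.prems, simp)
  moreover have "\<phi> l = \<psi> l"
    by (rule Cons.prems) (simp add: list_emb_Cons)
  ultimately show ?case by simp
qed simp

text \<open>
  The standard triangulation of the prism over a simplex, with bottom given by \<open>f\<close> and top by \<open>g\<close>.
\<close>

primrec prism :: "('a \<Rightarrow> 'b) \<Rightarrow> ('a \<Rightarrow> 'b) \<Rightarrow> 'a list \<Rightarrow> 'b list list" where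
  "prism f g [] = []"
| "prism f g (x # l) = (f x # map g (x # l)) # map ((#) (f x)) (prism f g l)"

text \<open>
  The chain homotopy identity: the boundary of the prism consists of its bottom, its top, and the
  prism over the boundary.
\<close>

lemma prism_formula:
  "total (coboundary \<phi>) (prism f g l) + coboundary (\<lambda>m. total \<phi> (prism f g m)) l = \<phi> (map f l) + \<phi> (map g l)"
proof (induction l arbitrary: \<phi>)
  case (Cons x l)
  have IH: "total (coboundary (\<lambda>m. \<phi> (f x # m))) (prism f g l) =
     coboundary (\<lambda>m. total (\<lambda>m. \<phi> (f x # m)) (prism f g m)) l + \<phi> (f x # map f l) + \<phi> (f x # map g l)"
    unfolding add.assoc by (rule bit_transpose) (rule Cons.IH)
  let ?a = "coboundary (\<lambda>m. \<phi> (f x # g x # map g m)) l"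
  let ?b = "total \<phi> (prism f g l)"
  let ?c = "coboundary (\<lambda>m. total (\<lambda>m. \<phi> (f x # m)) (prism f g m)) l"
  have "total (coboundary \<phi>) (prism f g (x # l)) = \<phi> (g x # map g l) + (\<phi> (f x # map g l) + ?a)
      + (?b + total (coboundary (\<lambda>m. \<phi> (f x # m))) (prism f g l))"
    by (simp add: total_add coboundary_map o_def)
  also have "\<dots> = \<phi> (g x # map g l) + (\<phi> (f x # map g l) + ?a)
      + (?b + (?c + \<phi> (f x # map f l) + \<phi> (f x # map g l)))"
    by (simp only: IH)
  finally have 1: "total (coboundary \<phi>) (prism f g (x # l)) = \<dots>" .
  have 2: "coboundary (\<lambda>m. total \<phi> (prism f g m)) (x # l) = ?b + (?a + ?c)"
    by (simp add: coboundary_add o_def)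
  have "\<phi> (g x # map g l) + (u + a) + (b + (c + v + u)) + (b + (a + c)) = v + \<phi> (g x # map g l)"
    for u v a b c :: bit
    by (cases u; cases v; cases a; cases b; cases c; cases "\<phi> (g x # map g l)")
       (simp_all only: bit_double bit_double_left add_0_left add_0_right)
  then show ?case
    by (simp only: 1 2 list.map)
qed simp

lemma prism_set: "m \<in> set (prism f g l) \<Longrightarrow> set m \<subseteq> f ` set l \<union> g ` set l"
proof (induction l arbitrary: m)
  case (Cons x l)
  from Cons.prems consider "m = f x # map g (x # l)" | m' where "m' \<in> set (prism f g l)" "m = f x # m'"
    by auto
  then show ?case
    by cases (auto dest: Cons.IH)
qed simp

lemma prism_length: "m \<in> set (prism f g l) \<Longrightarrow> length m = Suc (length l)"
  by (induction l arbitrary: m) auto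

section \<open>Counting alternating simplices\<close>

fun alt :: "bool \<Rightarrow> bool list \<Rightarrow> bit" where
  "alt b [] = 1"
| "alt b (x # xs) = (if x = b then alt (\<not> b) xs else 0)"

text \<open>
  Deleting one entry of a nonempty list of signs leaves an alternating list with first sign \<open>b\<close> an odd number of
  times exactly if the list itself alternates: then only the deletion of the first or only that of the
  last entry counts, and otherwise the good deletions, if there are any, are the two entries of a pair
  of equal neighbours.
\<close>

lemma coboundary_alt: "coboundary (alt b) xs = alt True xs + alt False xs"
proof (induction xs arbitrary: b)
  case (Cons x xs)
  show ?case
    using Cons.IH[of "\<not> b"] by (cases "x = b"; cases x; cases b) (simp_all add: coboundary_zero ac_simps)
qed simp

lemma alt_Not: "alt b (map Not xs) = alt (\<not> b) xs"
  by (induction xs arbitrary: b) auto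

text \<open>
  Deleting a position is deleting an element of the multiset of entries.
\<close>

lemma coboundary_perm:
  assumes "\<And>l l'. mset l = mset l' \<Longrightarrow> \<phi> l = \<phi> l'"
  shows "mset l = mset l' \<Longrightarrow> coboundary \<phi> l = coboundary \<phi> l'"
proof -
  have *: "coboundary \<psi> l = (\<Sum>x\<in>#mset l. \<Phi> (mset l - {#x#}))" if "\<And>l. \<psi> l = \<Phi> (mset l)" for \<psi> \<Phi> and l :: "'a list"
    using that
  proof (induction l arbitrary: \<psi> \<Phi>)
    case (Cons x l)
    have "coboundary (\<lambda>m. \<psi> (x # m)) l = (\<Sum>y\<in>#mset l. \<Phi> (add_mset x (mset l - {#y#})))"
      by (rule Cons.IH[of _ "\<lambda>M. \<Phi> (add_mset x M)"]) (simp add: Cons.prems)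
    also have "\<dots> = (\<Sum>y\<in>#mset l. \<Phi> (add_mset x (mset l) - {#y#}))"
      by (rule arg_cong[where f=sum_mset], rule image_mset_cong) (metis add_mset_remove_trivial diff_union_swap2 insert_DiffM)
    finally show ?case by (simp add: Cons.prems)
  qed simp
  have "\<phi> l = (\<lambda>M. \<phi> (SOME l. mset l = M)) (mset l)" for l
    using assms[of l "SOME l'. mset l' = mset l"] someI[of "\<lambda>l'. mset l' = mset l" l] by simp
  from *[of \<phi> "\<lambda>M. \<phi> (SOME l. mset l = M)", OF this]
  show "mset l = mset l' \<Longrightarrow> coboundary \<phi> l = coboundary \<phi> l'" by simp
qed

lemma coboundary_repeat:
  assumes "\<And>ys' zs'. \<phi> (ys' @ a # a # zs') = 0"
  shows "coboundary \<phi> (ys @ a # a # zs) = 0"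
  using assms
proof (induction ys arbitrary: \<phi>)
  case Nil
  have "coboundary (\<lambda>m. \<phi> (a # a # m)) zs = coboundary (\<lambda>m. 0) zs"
    by (rule coboundary_cong) (metis Nil append_Nil)
  then show ?case by (simp add: coboundary_zero)
next
  case (Cons y ys)
  have "coboundary (\<lambda>m. \<phi> (y # m)) (ys @ a # a # zs) = 0"
    by (rule Cons.IH) (metis Cons.prems append_Cons)
  then show ?case by (simp add: Cons.prems)
qed

text \<open>
  A labelled simplex is a list of colours with signs. It is counted if its colours are distinct and
  its signs alternate, beginning with \<open>b\<close>, when it is read in increasing order of colours; these are
  the alternating simplices of Ky Fan's generalisation of Tucker's lemma.
\<close>

definition fan :: "bool \<Rightarrow> (nat \<times> bool) list \<Rightarrow> bit" where
  "fan b l = (if distinct (map fst l) then alt b (map snd (sort_key fst l)) else 0)"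

lemma fan_perm: "mset l = mset l' \<Longrightarrow> fan b l = fan b l'"
proof -
  assume m: "mset l = mset l'"
  have d: "distinct (map fst l) \<longleftrightarrow> distinct (map fst l')"
    by (metis m mset_eq_imp_distinct_iff mset_map)
  have "sort_key fst l' = sort_key fst l" if "distinct (map fst l)"
  proof (rule sort_key_inj_key_eq)
    show "mset l' = mset (sort_key fst l)" using m by simp
    show "inj_on fst (set l')" using that d distinct_map by blast
    show "sorted (map fst (sort_key fst l))" by simp
  qed
  then show ?thesis using d by (simp add: fan_def)
qed

lemma fan_sorted:
  assumes "sorted (map fst l)" "distinct (map fst l)"
  shows "fan b l = alt b (map snd l)"
  using assms by (simp add: fan_def sorted_sort_id sort_key_id_if_sorted)

lemma adjacent_repeat:
  assumes "sorted (map f l)" "\<not> distinct (map f l)"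
  shows "\<exists>ys a b zs. l = ys @ a # b # zs \<and> f a = f b"
  using assms
proof (induction l)
  case (Cons x l)
  show ?case
  proof (cases "distinct (map f l)")
    case False
    then obtain ys a b zs where "l = ys @ a # b # zs" "f a = f b"
      using Cons by auto
    then have "x # l = (x # ys) @ a # b # zs \<and> f a = f b" by simp
    then show ?thesis by blast
  next
    case True
    then obtain y where y: "y \<in> set l" "f x = f y" using Cons.prems by auto
    then obtain z zs where l: "l = z # zs" by (cases l) auto
    have "f x \<le> f z" "f z \<le> f y" using Cons.prems y l by auto
    then have "f x = f z" using y by simp
    then have "x # l = [] @ x # z # zs \<and> f x = f z" using l by simp
    then show ?thesis by blast
  qed
qed simp

text \<open>
  The local step of Ky Fan's parity argument. If no colour occurs with both signs, then a repeated
  colour is a repeated entry \<open>a\<close>; the two facets that omit one copy of \<open>a\<close> coincide, and all others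
  still repeat \<open>a\<close>. If the colours are distinct, the statement is the one for lists of signs.
\<close>

lemma coboundary_fan:
  assumes good: "\<And>x y. x \<in> set l \<Longrightarrow> y \<in> set l \<Longrightarrow> fst x = fst y \<Longrightarrow> x = y"
  shows "coboundary (fan b) l = fan True l + fan False l"
proof -
  define s where "s = sort_key fst l"
  have s: "sorted (map fst s)" "mset s = mset l" "set s = set l"
    by (simp_all add: s_def)
  have l_s: "coboundary (fan b) l = coboundary (fan b) s" "fan c l = fan c s" for c
    using s(2) by (auto intro!: coboundary_perm fan_perm)
  show ?thesis
  proof (cases "distinct (map fst s)")
    case True
    have "coboundary (fan b) s = coboundary (\<lambda>m. alt b (map snd m)) s"
    proof (rule coboundary_cong)
      fix m assume "subseq m s"
      then have "subseq (map fst m) (map fst s)" by (rule subseq_map)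
      then have "sorted (map fst m)" "distinct (map fst m)"
        using s(1) True by (metis subseq_conv_nths sorted_nths, metis subseq_conv_nths distinct_nthsI)
      then show "fan b m = alt b (map snd m)" by (rule fan_sorted)
    qed
    also have "\<dots> = alt True (map snd s) + alt False (map snd s)"
      by (simp add: coboundary_map [symmetric] coboundary_alt)
    finally show ?thesis
      by (simp add: l_s fan_sorted [OF s(1) True])
  next
    case False
    then obtain ys a a' zs where eq: "s = ys @ a # a' # zs" "fst a = fst a'"
      using adjacent_repeat [OF s(1)] by blast
    then have "a' = a"
      using good [of a' a] s(3) by auto
    then have "s = ys @ a # a # zs" using eq by simp
    moreover have "coboundary (fan b) (ys @ a # a # zs) = 0"
      by (rule coboundary_repeat) (simp add: fan_def)
    moreover have "fan c (ys @ a # a # zs) = 0" for c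
      by (simp add: fan_def)
    ultimately show ?thesis by (simp add: l_s)
  qed
qed

lemma fan_Not: "fan b (map (apsnd Not) l) = fan (\<not> b) l"
proof (cases "distinct (map fst l)")
  case True
  have "sort_key fst (map (apsnd Not) l) = map (apsnd Not) (sort_key fst l)"
  proof (rule sort_key_inj_key_eq)
    show "inj_on fst (set (map (apsnd Not) l))"
      using True by (auto simp: distinct_map inj_on_def)
  qed (simp_all add: o_def)
  then show ?thesis using True
    by (simp add: fan_def o_def flip: alt_Not)
qed (simp add: fan_def o_def)

section \<open>Spheres in the box complex of a digraph\<close>

definition adj :: "'v rel \<Rightarrow> 'v \<Rightarrow> 'v \<Rightarrow> bool" where
  "adj E u v \<longleftrightarrow> (u, v) \<in> E \<or> (v, u) \<in> E"

abbreviation neg :: "'v \<times> bool \<Rightarrow> 'v \<times> bool" where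
  "neg \<equiv> apsnd Not"

text \<open>
  A simplex of the box complex: every vertex with sign \<^const>\<open>True\<close> is adjacent to every vertex with
  sign \<^const>\<open>False\<close>. Either side may be empty.
\<close>

definition box_simplex :: "'v set \<Rightarrow> 'v rel \<Rightarrow> ('v \<times> bool) list \<Rightarrow> bool" where
  "box_simplex V E l \<longleftrightarrow> fst ` set l \<subseteq> V \<and>
     (\<forall>u v. (u, True) \<in> set l \<longrightarrow> (v, False) \<in> set l \<longrightarrow> adj E u v)"

text \<open>
  A purely combinatorial substitute for an antipodal map from the \<open>n\<close>-dimensional sphere into the box
  complex: \<open>c i\<close> is the image of a closed \<open>i\<close>-dimensional hemisphere. Its boundary is the
  equator, which is made up of the hemisphere \<open>c (i - 1)\<close> and its antipode.
\<close>

definition has_sphere :: "nat \<Rightarrow> 'v set \<Rightarrow> 'v rel \<Rightarrow> bool" where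
  "has_sphere n V E \<longleftrightarrow> (\<exists>c :: nat \<Rightarrow> ('v \<times> bool) list list.
     (\<forall>i\<le>n. \<forall>l\<in>set (c i). length l = Suc i \<and> box_simplex V E l) \<and>
     length (c 0) = 1 \<and>
     (\<forall>i<n. \<forall>\<phi>. total (coboundary \<phi>) (c (Suc i)) = total \<phi> (c i) + total (\<lambda>l. \<phi> (map neg l)) (c i)))"

text \<open>
  The Borsuk-Ulam theorem in the form of Ky Fan. A proper colouring gives no colour both signs within a
  simplex of the box complex. So, by \<open>coboundary_fan\<close>, the number of
  alternating simplices has the same parity in all hemispheres, and it is odd in dimension 0. An alternating simplex in dimension \<open>n\<close> uses \<open>n + 1\<close>
  colours.
\<close>

lemma has_sphere_colours:
  fixes f :: "'v \<Rightarrow> nat"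
  assumes "has_sphere n V E" and f: "f ` V \<subseteq> {..<q}" "\<And>u v. (u, v) \<in> E \<Longrightarrow> f u \<noteq> f v"
  shows "n < q"
proof -
  from assms(1) obtain c :: "nat \<Rightarrow> ('v \<times> bool) list list" where
    c: "\<And>i l. i \<le> n \<Longrightarrow> l \<in> set (c i) \<Longrightarrow> length l = Suc i \<and> box_simplex V E l"
    and c0: "length (c 0) = 1"
    and bd_c: "\<And>i \<phi>. i < n \<Longrightarrow> total (coboundary \<phi>) (c (Suc i)) = total \<phi> (c i) + total (\<lambda>l. \<phi> (map neg l)) (c i)"
    unfolding has_sphere_def by blast
  define lab where "lab = map (map_prod f (id :: bool \<Rightarrow> bool))"
  have neg_lab: "fan b (lab (map neg l)) = fan (\<not> b) (lab l)" for b l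
    by (simp add: lab_def o_def apsnd_def map_prod.compositionality flip: fan_Not)
  have bd_lab: "coboundary (\<lambda>l. fan b (lab l)) l = fan True (lab l) + fan False (lab l)"
    if "box_simplex V E l" for b l
  proof -
    have ne: "f u \<noteq> f v" if "(u, True) \<in> set l" "(v, False) \<in> set l" for u v
      using that \<open>box_simplex V E l\<close> f(2) [of u v] f(2) [of v u]
      unfolding box_simplex_def adj_def by metis
    have "x = y" if xy: "x \<in> set (lab l)" "y \<in> set (lab l)" "fst x = fst y" for x y
    proof -
      obtain u v a b where uv: "(u, a) \<in> set l" "(v, b) \<in> set l" "x = (f u, a)" "y = (f v, b)"
        using xy by (auto simp: lab_def)
      then show ?thesis
        using ne [of u v] ne [of v u] xy(3) by (cases a; cases b) auto
    qed
    then have "coboundary (fan b) (lab l) = fan True (lab l) + fan False (lab l)"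
      by (rule coboundary_fan)
    then show ?thesis by (simp add: lab_def coboundary_map)
  qed
  have "total (\<lambda>l. fan True (lab l) + fan False (lab l)) (c i) = 1" if "i \<le> n" for i
    using that
  proof (induction i)
    case 0
    obtain l where l: "c 0 = [l]" using c0 by (cases "c 0") auto
    then obtain x where "l = [x]" using c [of 0 l] by (cases l) auto
    then show ?case using l by (cases x) (simp add: lab_def fan_def)
  next
    case (Suc i)
    have "total (\<lambda>l. fan True (lab l) + fan False (lab l)) (c (Suc i)) = total (coboundary (\<lambda>l. fan True (lab l))) (c (Suc i))"
      using c [OF Suc.prems] bd_lab by (intro arg_cong[where f=sum_list] map_cong) auto
    also have "\<dots> = total (\<lambda>l. fan True (lab l)) (c i) + total (\<lambda>l. fan False (lab l)) (c i)"
      using Suc.prems by (simp add: bd_c neg_lab)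
    finally show ?case using Suc by (simp add: total_add)
  qed
  then have "total (\<lambda>l. fan True (lab l) + fan False (lab l)) (c n) = 1"
    by simp
  moreover have "total g xs = 0" if "\<forall>x\<in>set xs. g x = 0" for g :: "('v \<times> bool) list \<Rightarrow> bit" and xs
    using that by (induction xs) auto
  ultimately have "\<not> (\<forall>l\<in>set (c n). fan True (lab l) + fan False (lab l) = 0)"
    by force
  then obtain l where l: "l \<in> set (c n)" "fan True (lab l) + fan False (lab l) \<noteq> 0"
    by blast
  then have "distinct (map fst (lab l))"
    by (auto simp: fan_def split: if_splits)
  then have "card (set (map fst (lab l))) = Suc n"
    using c [OF order_refl l(1)] by (simp add: distinct_card lab_def del: set_map)
  moreover have "set (map fst (lab l)) \<subseteq> {..<q}"
    using c [OF order_refl l(1)] f(1) by (auto simp: lab_def box_simplex_def)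
  ultimately have "Suc n \<le> q"
    by (metis card_lessThan card_mono finite_lessThan)
  then show ?thesis by simp
qed

section \<open>Generalised Mycielskians\<close>

text \<open>
  The generalised Mycielskian of a digraph has levels \<open>0, \<dots>, r\<close>, each of which is a copy of the
  vertex set. Level 0 is a copy of the digraph, every arc also joins neighbouring levels, and an apex
  is joined to all of level \<open>r\<close>. The type contains all iterated levels, so that the
  construction can be repeated without a change of type. All arcs at the apex leave it: the
  indegrees then are bounded in terms of the number of iterations, and only the outdegrees depend on the
  number of levels.
\<close>

datatype vertex = Apex | Lev nat vertex

definition myc_verts :: "nat \<Rightarrow> vertex set \<Rightarrow> vertex set" where
  "myc_verts r V = insert Apex {Lev i u | i u. i \<le> r \<and> u \<in> V}"

definition consecutive :: "nat \<Rightarrow> nat \<Rightarrow> bool" where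
  "consecutive i j \<longleftrightarrow> i = 0 \<and> j = 0 \<or> i = Suc j \<or> j = Suc i"

definition myc_arcs :: "nat \<Rightarrow> vertex set \<Rightarrow> vertex rel \<Rightarrow> vertex rel" where
  "myc_arcs r V E = {(Lev i u, Lev j v) | i j u v. i \<le> r \<and> j \<le> r \<and> consecutive i j \<and> (u, v) \<in> E} \<union>
     {(Apex, Lev r u) | u. u \<in> V}"

text \<open>
  The positions of the vertices with sign \<open>b\<close> in step \<open>k\<close> of a walk from level 0 to the top. The two
  signs move up alternately, in steps of 2, except that the side with sign \<^const>\<open>False\<close> starts with
  a step of 1. After step 0, the positive side stands on even levels, the negative side on odd ones.
\<close>

definition level :: "nat \<Rightarrow> bool \<Rightarrow> nat" where
  "level k b = (if b then 2 * (k div 2) else 2 * ((k + 1) div 2) - 1)"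

lemma level_le: "level k b \<le> k"
proof -
  have "2 * (k div 2) \<le> k" "2 * ((k + 1) div 2) - 1 \<le> k" by presburger+
  then show ?thesis by (cases b) (simp_all only: level_def if_True if_False)
qed

lemma consecutive_level:
  assumes "p = level k True \<or> p = level (Suc k) True" "q = level k False \<or> q = level (Suc k) False"
  shows "consecutive p q"
proof -
  have lev: "level k True = 2 * (k div 2)" "level k False = 2 * ((k + 1) div 2) - 1" for k
    by (simp_all only: level_def if_True if_False)
  obtain a where "k = 2 * a \<or> k = 2 * a + 1"
    by (metis mult_div_mod_eq mod2_eq_if add_0_right)
  then show ?thesis
    using assms by (elim disjE; cases a) (simp_all add: lev consecutive_def)
qed

lemma consecutive_sym: "consecutive i j \<longleftrightarrow> consecutive j i"
  by (auto simp: consecutive_def)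

text \<open>
  The new space contains the suspension of the old one. The sphere formed by the top hemisphere of the
  old system and its antipode lives on level 0. It is moved upwards by prisms, one side at a time; as
  the two sides always stand on level 0 or on neighbouring levels, all simplices on the way belong to the box
  complex. For odd \<open>r\<close> the walk ends with the negative side on level \<open>r\<close>, all of whose vertices are
  adjacent to the apex, so that the sphere can be coned off by the positive apex. Prisms and cone form
  the new hemisphere, and its boundary is the sphere on level 0.
\<close>

lemma has_sphere_myc:
  assumes "has_sphere n V E" and "odd r"
  shows "has_sphere (Suc n) (myc_verts r V) (myc_arcs r V E)"
proof -
  from assms(1) obtain c :: "nat \<Rightarrow> (vertex \<times> bool) list list" where
    c: "\<And>i l. i \<le> n \<Longrightarrow> l \<in> set (c i) \<Longrightarrow> length l = Suc i \<and> box_simplex V E l"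
    and c0: "length (c 0) = 1"
    and bd_c: "\<And>i \<phi>. i < n \<Longrightarrow> total (coboundary \<phi>) (c (Suc i)) = total \<phi> (c i) + total (\<lambda>l. \<phi> (map neg l)) (c i)"
    unfolding has_sphere_def by blast
  define f where "f = (\<lambda>k (u, b). (Lev (level k b) u, b))"
  define S where "S = c n @ map (map neg) (c n)"
  define P where "P k = concat (map (prism (f k) (f (Suc k))) S)" for k
  define c' where "c' i = (if i \<le> n then map (map (f 0)) (c i)
     else concat (map P [0..<r]) @ map (\<lambda>l. (Apex, True) # map (f r) l) S)" for i
  have neg_neg: "neg \<circ> neg = (id :: vertex \<times> bool \<Rightarrow> _)" by (auto simp: fun_eq_iff)
  have map_neg: "map neg (map (f 0) l) = map (f 0) (map neg l)" for l
    by (auto simp: f_def level_def)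

  have S: "length l = Suc n \<and> box_simplex V E l" if "l \<in> set S" for l
    using that c [of n]
    by (fastforce simp: S_def box_simplex_def adj_def apsnd_def)

  \<comment> \<open>The sphere has no boundary: the boundaries of the two hemispheres cancel.\<close>
  have cycle: "total (coboundary \<psi>) S = 0" for \<psi>
  proof (cases n)
    case 0
    obtain l where l: "c 0 = [l]" using c0 by (cases "c 0") auto
    then obtain x where "l = [x]" using c [of 0 l] by (cases l) auto
    then show ?thesis using l 0 by (simp add: S_def)
  next
    case (Suc m)
    have "total (coboundary \<psi>) (map (map neg) (c n)) = total (coboundary (\<lambda>l. \<psi> (map neg l))) (c n)"
      by (simp add: o_def coboundary_map)
    then show ?thesis
      using Suc bd_c [of m] by (simp add: S_def neg_neg ac_simps)
  qed

  define A where "A k \<phi> = total (\<lambda>l. \<phi> (map (f k) l)) S" for k \<phi>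
  have ev_concat: "total \<phi> (concat (map h xs)) = total (\<lambda>x. total \<phi> (h x)) xs"
    for \<phi> :: "'x \<Rightarrow> bit" and h :: "'y \<Rightarrow> 'x list" and xs
    by (induction xs) simp_all
  have bd_P: "total (coboundary \<phi>) (P k) = A k \<phi> + A (Suc k) \<phi>" for k \<phi>
  proof -
    have "total (coboundary \<phi>) (P k) = total (\<lambda>l. coboundary (\<lambda>m. total \<phi> (prism (f k) (f (Suc k)) m)) l
        + (\<phi> (map (f k) l) + \<phi> (map (f (Suc k)) l))) S"
      unfolding P_def ev_concat
      by (rule arg_cong[where f="\<lambda>h. total h S"], rule ext, rule bit_transpose, rule prism_formula)
    also have "\<dots> = A k \<phi> + A (Suc k) \<phi>"
      unfolding total_add cycle A_def by simp
    finally show ?thesis .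
  qed
  have bd_prisms: "total (coboundary \<phi>) (concat (map P [0..<k])) = A 0 \<phi> + A k \<phi>" for k \<phi>
    by (induction k) (simp_all add: bd_P ac_simps)
  have bd_cone: "total (coboundary \<phi>) (map (\<lambda>l. (Apex, True) # map (f r) l) S) = A r \<phi>" for \<phi>
    using cycle [of "\<lambda>l. \<phi> ((Apex, True) # map (f r) l)"]
    by (simp add: o_def total_add A_def coboundary_map)

  have simplices: "length l = Suc i \<and> box_simplex (myc_verts r V) (myc_arcs r V E) l"
    if i: "i \<le> Suc n" and l: "l \<in> set (c' i)" for i l
  proof -
    \<comment> \<open>Prisms and the final level are covered by the same argument.\<close>
    have two_levels: "box_simplex (myc_verts r V) (myc_arcs r V E) l"
      if m: "box_simplex V E m" "set l \<subseteq> f k ` set m \<union> f (Suc k) ` set m" "Suc k \<le> r" for k l m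
      unfolding box_simplex_def
    proof (intro conjI allI impI)
      have "level k b \<le> r" "level (Suc k) b \<le> r" for b
        using level_le [of k b] level_le [of "Suc k" b] m(3) by auto
      then show "fst ` set l \<subseteq> myc_verts r V"
        using m(1) by (auto simp: box_simplex_def f_def myc_verts_def dest!: subsetD [OF m(2)])
      have origin: "\<exists>p u'. u = Lev p u' \<and> (u', b) \<in> set m \<and> (p = level k b \<or> p = level (Suc k) b)"
        if "(u, b) \<in> set l" for u b
        using subsetD [OF m(2) that] by (auto simp: f_def)
      fix u v assume "(u, True) \<in> set l" "(v, False) \<in> set l"
      then obtain p q u' v' where uv: "u = Lev p u'" "v = Lev q v'" "(u', True) \<in> set m" "(v', False) \<in> set m"
        and pq: "p = level k True \<or> p = level (Suc k) True" "q = level k False \<or> q = level (Suc k) False"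
        using origin by meson
      have "adj E u' v'" using uv m(1) by (auto simp: box_simplex_def)
      moreover have "consecutive p q" "consecutive q p"
        using consecutive_level [OF pq] consecutive_sym by auto
      moreover have "p \<le> r" "q \<le> r"
        using pq level_le [of k] level_le [of "Suc k"] m(3) by (metis le_trans nat_le_linear not_less_eq_eq)+
      ultimately show "adj (myc_arcs r V E) u v"
        by (auto simp: adj_def myc_arcs_def uv)
    qed
    have r: "r = Suc (r - 1)" using \<open>odd r\<close> by (cases r) auto
    consider (low) m where "i \<le> n" "m \<in> set (c i)" "l = map (f 0) m"
      | (prism) k m where "i = Suc n" "k < r" "m \<in> set S" "l \<in> set (prism (f k) (f (Suc k)) m)"
      | (cone) m where "i = Suc n" "m \<in> set S" "l = (Apex, True) # map (f r) m"
      using i l by (auto simp: c'_def P_def le_Suc_eq split: if_splits)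
    then show ?thesis
    proof cases
      case low
      then show ?thesis using c [of i m] two_levels [of m l 0] r by auto
    next
      case prism
      then show ?thesis
        using S [of m] two_levels [of m l k] prism_set [OF prism(4)] prism_length [OF prism(4)] by auto
    next
      case cone
      have "box_simplex (myc_verts r V) (myc_arcs r V E) (map (f r) m)"
        using two_levels [of m "map (f r) m" "r - 1"] S [OF cone(2)] r by auto
      moreover have "adj (myc_arcs r V E) Apex v" if "(v, False) \<in> set (map (f r) m)" for v
      proof -
        from that obtain v' where "v = Lev (level r False) v'" "(v', False) \<in> set m"
          by (auto simp: f_def)
        moreover have "level r False = r" using \<open>odd r\<close> by (auto simp: level_def elim: oddE)
        ultimately show ?thesis
          using S [OF cone(2)] by (force simp: adj_def myc_arcs_def box_simplex_def)
      qed
      ultimately show ?thesis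
        using cone S [OF cone(2)] by (auto simp: box_simplex_def myc_verts_def)
    qed
  qed

  show ?thesis
    unfolding has_sphere_def
  proof (intro exI [of _ c'] conjI allI impI ballI)
    fix i and \<phi> :: "(vertex \<times> bool) list \<Rightarrow> bit"
    assume "i < Suc n"
    then consider "i < n" | "i = n" by linarith
    then show "total (coboundary \<phi>) (c' (Suc i)) = total \<phi> (c' i) + total (\<lambda>l. \<phi> (map neg l)) (c' i)"
    proof cases
      case 1
      then have "total (coboundary \<phi>) (c' (Suc i)) = total (coboundary (\<lambda>l. \<phi> (map (f 0) l))) (c (Suc i))"
        by (simp add: c'_def o_def coboundary_map)
      also have "\<dots> = total (\<lambda>l. \<phi> (map (f 0) l)) (c i) + total (\<lambda>l. \<phi> (map (f 0) (map neg l))) (c i)"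
        using 1 by (rule bd_c)
      also have "\<dots> = total \<phi> (c' i) + total (\<lambda>l. \<phi> (map neg l)) (c' i)"
        using 1 by (simp add: c'_def total_map map_neg del: map_map)
      finally show ?thesis .
    next
      case 2
      have "total (coboundary \<phi>) (c' (Suc i)) = A 0 \<phi> + A r \<phi> + A r \<phi>"
        using 2 by (simp add: c'_def bd_prisms bd_cone del: map_map)
      also have "\<dots> = A 0 \<phi>"
        by (simp add: add.assoc)
      also have "\<dots> = total \<phi> (c' i) + total (\<lambda>l. \<phi> (map neg l)) (c' i)"
        using 2 by (simp add: A_def S_def c'_def total_map map_neg del: map_map)
      finally show ?thesis .
    qed
  qed (use simplices c0 in \<open>auto simp: c'_def\<close>)
qed

lemma has_sphere_point: "has_sphere 0 {Apex} {}"
  unfolding has_sphere_def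
  by (rule exI [of _ "\<lambda>_. [[(Apex, True)]]"]) (auto simp: box_simplex_def)

section \<open>Colouring subdigraphs of small outdegree\<close>

text \<open>
  The set \<open>A\<close> of vertices that avoid the third colour is there for the sake of induction: it says that
  a small set of vertices can be kept available for other purposes.
\<close>

definition sparse_3colourable :: "nat \<Rightarrow> 'v rel \<Rightarrow> bool" where
  "sparse_3colourable M E \<longleftrightarrow> (\<forall>F A. F \<subseteq> E \<longrightarrow> (\<forall>u. card (F `` {u}) \<le> M) \<longrightarrow> finite A \<longrightarrow> card A \<le> M \<longrightarrow>
     (\<exists>\<phi> :: 'v \<Rightarrow> nat. (\<forall>x. \<phi> x < 3) \<and> (\<forall>u v. (u, v) \<in> F \<longrightarrow> \<phi> u \<noteq> \<phi> v) \<and> (\<forall>a\<in>A. \<phi> a < 2)))"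

lemma finite_myc_verts: "finite V \<Longrightarrow> finite (myc_verts r V)"
proof -
  assume "finite V"
  moreover have "{Lev i u | i u. i \<le> r \<and> u \<in> V} = (\<lambda>(i, u). Lev i u) ` ({..r} \<times> V)"
    by auto
  ultimately show ?thesis by (simp add: myc_verts_def)
qed

lemma myc_arcs_field: "E \<subseteq> V \<times> V \<Longrightarrow> myc_arcs r V E \<subseteq> myc_verts r V \<times> myc_verts r V"
  by (auto simp: myc_arcs_def myc_verts_def)

lemma myc_indegree:
  assumes "finite E" and K: "\<And>v. card (E\<inverse> `` {v}) \<le> K"
  shows "card ((myc_arcs r V E)\<inverse> `` {w}) \<le> 2 * K + 1"
proof (cases w)
  case Apex
  then have "(myc_arcs r V E)\<inverse> `` {w} = {}" by (auto simp: myc_arcs_def)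
  then show ?thesis by simp
next
  case (Lev j v)
  let ?I = "{i. consecutive i j}"
  have I: "?I \<subseteq> {Suc j, j - 1}" by (auto simp: consecutive_def)
  have sub: "(myc_arcs r V E)\<inverse> `` {w} \<subseteq> insert Apex ((\<lambda>(i, u). Lev i u) ` ({Suc j, j - 1} \<times> E\<inverse> `` {v}))"
    using I by (force simp: Lev myc_arcs_def)
  have fin: "finite (E\<inverse> `` {v})" using \<open>finite E\<close> by (simp add: finite_Image)
  have "card ((\<lambda>(i, u). Lev i u) ` ({Suc j, j - 1} \<times> E\<inverse> `` {v})) \<le> card ({Suc j, j - 1} \<times> E\<inverse> `` {v})"
    using fin by (intro card_image_le) simp
  also have "\<dots> \<le> 2 * K"
    using K [of v] by (simp add: card_cartesian_product card_insert_if)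
  finally have "card (insert Apex ((\<lambda>(i, u). Lev i u) ` ({Suc j, j - 1} \<times> E\<inverse> `` {v}))) \<le> 2 * K + 1"
    using fin by (simp add: card_insert_if)
  moreover have "card ((myc_arcs r V E)\<inverse> `` {w}) \<le> card (insert Apex ((\<lambda>(i, u). Lev i u) ` ({Suc j, j - 1} \<times> E\<inverse> `` {v})))"
    using fin by (intro card_mono [OF _ sub]) auto
  ultimately show ?thesis by linarith
qed

text \<open>
  Project a subdigraph \<open>F\<close> of small outdegree to the old digraph; its outdegrees grow by a factor of at
  most \<open>r + 1\<close>, so the projection \<open>F'\<close> has a 3-colouring \<open>\<phi>\<close>, and \<open>\<phi>\<close> can be pulled back to all levels.
  Only the apex needs attention, and the apex has few neighbours in \<open>F\<close>.

  There are two consecutive levels \<open>l - 1\<close> and \<open>l\<close> without vertices of \<open>A\<close>. The vertices of \<open>A\<close>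
  above level \<open>l\<close>, the apex, and their neighbours on even levels form a set \<open>P\<close>, which is coloured by
  the parity of the levels. The colouring \<open>\<phi>\<close> is used away from \<open>P\<close>, and the set \<open>S\<close> of the remaining
  neighbours of \<open>P\<close> is a buffer that gets the third colour. This works because \<open>S\<close> lies on odd levels
  only and is thus independent, because \<open>S\<close> lies on level \<open>l - 1\<close> or above and does not meet \<open>A\<close>, and
  because \<open>\<phi>\<close> can be asked to avoid the third colour on a small set \<open>B\<close> that contains the projections of
  \<open>A\<close> and of all neighbours of \<open>S\<close>.
\<close>

lemma sparse_3colourable_myc:
  fixes V :: "vertex set"
  assumes "finite E" and K: "\<And>v. card (E\<inverse> `` {v}) \<le> K"
    and r: "r \<ge> 2 * M + 2"
    and M': "M' \<ge> (r + 1) * M" "M' \<ge> (M + 1) * (M + 2 * K + 2) ^ 3"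
    and E: "sparse_3colourable M' E"
    and "finite V"
  shows "sparse_3colourable M (myc_arcs r V E)"
  unfolding sparse_3colourable_def
proof (intro allI impI)
  fix F and A :: "vertex set"
  assume F: "F \<subseteq> myc_arcs r V E" and out: "\<forall>u. card (F `` {u}) \<le> M"
    and A: "finite A" "card A \<le> M"
  define lev where "lev x = (case x of Apex \<Rightarrow> r + 1 | Lev i u \<Rightarrow> i)" for x
  define prj where "prj x = (case x of Apex \<Rightarrow> Apex | Lev i u \<Rightarrow> u)" for x
  have lev_simps [simp]: "lev Apex = r + 1" "lev (Lev i u) = i" for i u
    by (simp_all add: lev_def)
  have prj_simps [simp]: "prj (Lev i u) = u" for i u
    by (simp add: prj_def)
  define N where "N x = F `` {x} \<union> F\<inverse> `` {x}" for x
  define nb where "nb X = X \<union> (\<Union>x\<in>X. N x)" for X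
  let ?D = "M + 2 * K + 2"

  have "myc_arcs r V E \<subseteq> (\<lambda>(i, j, u, v). (Lev i u, Lev j v)) ` ({..r} \<times> {..r} \<times> E) \<union> (\<lambda>u. (Apex, Lev r u)) ` V"
    by (force simp: myc_arcs_def)
  then have finE': "finite (myc_arcs r V E)"
    by (rule finite_subset) (use \<open>finite E\<close> \<open>finite V\<close> in auto)
  then have finF: "finite F" using F finite_subset by blast
  have finN: "finite (N x)" for x
    using finF by (simp add: N_def finite_Image)
  have cardN: "card (N x) \<le> M + 2 * K + 1" for x
  proof -
    have "card (F\<inverse> `` {x}) \<le> card ((myc_arcs r V E)\<inverse> `` {x})"
      using F finE' by (intro card_mono) (auto simp: finite_Image)
    then have "card (F\<inverse> `` {x}) \<le> 2 * K + 1"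
      using myc_indegree [OF \<open>finite E\<close> K] le_trans by blast
    then show ?thesis
      using card_Un_le [of "F `` {x}" "F\<inverse> `` {x}"] out [rule_format, of x]
      unfolding N_def by linarith
  qed
  have nb: "finite (nb X) \<and> card (nb X) \<le> card X * ?D" if "finite X" for X
  proof -
    have "card (\<Union>x\<in>X. N x) \<le> (\<Sum>x\<in>X. card (N x))"
      by (rule card_UN_le [OF that])
    also have "\<dots> \<le> card X * (M + 2 * K + 1)"
      using sum_bounded_above [of X "\<lambda>x. card (N x)", OF cardN] by simp
    finally have "card (nb X) \<le> card X + card X * (M + 2 * K + 1)"
      using card_Un_le [of X "\<Union>x\<in>X. N x"] unfolding nb_def by linarith
    then show ?thesis using that finN by (simp add: nb_def algebra_simps)
  qed
  have N_sym: "y \<in> N x \<longleftrightarrow> x \<in> N y" for x y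
    by (auto simp: N_def)
  have N_F: "y \<in> N x" if "(x, y) \<in> F" for x y
    using that by (auto simp: N_def)
  have N_lev: "consecutive (lev x) (lev y)" if "y \<in> N x" for x y
    using that F by (auto simp: N_def myc_arcs_def consecutive_def)

  \<comment> \<open>The \<open>M + 1\<close> pairs of levels \<open>2 * j + 1\<close> and \<open>2 * j + 2\<close> cannot all be met by the \<open>M\<close> elements
     of \<open>A\<close>. Level 0 has to be avoided, since it has arcs between vertices of equal parity.\<close>
  obtain l where l: "2 \<le> l" "l \<le> r" and gap: "\<And>a. a \<in> A \<Longrightarrow> lev a \<noteq> l \<and> lev a \<noteq> l - 1"
  proof -
    have "card ((\<lambda>a. (lev a - 1) div 2) ` A) \<le> M"
      using A card_image_le le_trans by blast
    then have "\<not> {..M} \<subseteq> (\<lambda>a. (lev a - 1) div 2) ` A"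
      using card_mono [of "(\<lambda>a. (lev a - 1) div 2) ` A" "{..M}"] A by auto
    then obtain j where "j \<le> M" and j: "\<And>a. a \<in> A \<Longrightarrow> (lev a - 1) div 2 \<noteq> j"
      by blast
    show thesis
    proof (rule that [of "2 * j + 2"])
      show "2 * j + 2 \<le> r" using r \<open>j \<le> M\<close> by simp
      show "lev a \<noteq> 2 * j + 2 \<and> lev a \<noteq> 2 * j + 2 - 1" if "a \<in> A" for a
        using j [OF that] by auto
    qed simp
  qed

  define T where "T = {x \<in> insert Apex A. lev x > l}"
  define P where "P = T \<union> {y. even (lev y) \<and> (\<exists>x\<in>T. y \<in> N x)}"
  define S where "S = {y. y \<notin> P \<and> (\<exists>x\<in>P. y \<in> N x)}"
  define B where "B = prj ` nb (nb (nb (insert Apex A)))"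
  define F' where "F' = {(u, v). \<exists>i j. (Lev i u, Lev j v) \<in> F}"

  have lev_T: "lev x > l" if "x \<in> T" for x
    using that by (simp add: T_def)
  have lev_P: "lev x \<ge> l \<and> (x \<in> T \<or> even (lev x))" if x: "x \<in> P" for x
  proof (cases "x \<in> T")
    case False
    then obtain y where "y \<in> T" "x \<in> N y" "even (lev x)"
      using x by (auto simp: P_def)
    then show ?thesis
      using lev_T [of y] N_lev [of x y] l by (auto simp: consecutive_def)
  qed (use lev_T [of x] in simp)
  have lev_S: "lev y \<ge> l - 1" "odd (lev y)" if y: "y \<in> S" for y
  proof -
    obtain x where x: "x \<in> P" "y \<in> N x" using y by (auto simp: S_def)
    have xy: "consecutive (lev x) (lev y)" by (rule N_lev [OF x(2)])
    then show "lev y \<ge> l - 1" using lev_P [OF x(1)] l by (auto simp: consecutive_def)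
    show "odd (lev y)"
    proof (cases "x \<in> T")
      case True
      then show ?thesis using y x by (auto simp: S_def P_def)
    next
      case False
      then show ?thesis using lev_P [OF x(1)] xy l by (auto simp: consecutive_def)
    qed
  qed
  have P_nb: "P \<subseteq> nb (insert Apex A)"
    by (auto simp: P_def T_def nb_def)
  have S_nb: "S \<subseteq> nb (nb (insert Apex A))"
    using P_nb by (auto simp: S_def nb_def [of "nb _"])
  have S_B: "prj y \<in> B" if "x \<in> S" "y \<in> N x" for x y
    using that S_nb unfolding B_def nb_def [of "nb (nb _)"] by blast
  have A_B: "prj a \<in> B" if "a \<in> A" for a
    using that unfolding B_def nb_def by blast
  have S_A: "y \<notin> A" if "y \<in> S" for y
  proof
    assume "y \<in> A"
    then have "lev y > l" using lev_S [OF that] gap [of y] l by linarith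
    then have "y \<in> T" using \<open>y \<in> A\<close> by (simp add: T_def)
    then show False using that by (simp add: S_def P_def)
  qed

  have finB: "finite B" and cardB: "card B \<le> M'"
  proof -
    let ?A = "insert Apex A"
    have "finite ?A" "card ?A \<le> M + 1" using A by (auto simp: card_insert_if)
    note 1 = nb [OF \<open>finite ?A\<close>]
    note 2 = nb [OF conjunct1 [OF 1]]
    note 3 = nb [OF conjunct1 [OF 2]]
    show "finite B" using 3 by (simp add: B_def)
    have "card B \<le> card (nb (nb (nb ?A)))"
      unfolding B_def using 3 by (intro card_image_le) blast
    also have "\<dots> \<le> card (nb (nb ?A)) * ?D" using 3 by blast
    also have "\<dots> \<le> card (nb ?A) * ?D * ?D" using 2 by (intro mult_right_mono) auto
    also have "\<dots> \<le> card ?A * ?D * ?D * ?D" using 1 by (intro mult_right_mono) auto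
    also have "\<dots> \<le> (M + 1) * ?D * ?D * ?D"
      using \<open>card ?A \<le> M + 1\<close> by (intro mult_right_mono) auto
    also have "\<dots> = (M + 1) * ?D ^ 3"
      by (simp only: power3_eq_cube mult.assoc)
    finally show "card B \<le> M'" using M'(2) by linarith
  qed
  have "F' \<subseteq> E"
    using F by (auto simp: F'_def myc_arcs_def)
  moreover have "card (F' `` {u}) \<le> M'" for u
  proof -
    have sub: "F' `` {u} \<subseteq> (\<Union>i\<le>r. prj ` (F `` {Lev i u}))"
    proof
      fix v assume "v \<in> F' `` {u}"
      then obtain i j where "(Lev i u, Lev j v) \<in> F" by (auto simp: F'_def)
      moreover from this have "i \<le> r" using F by (auto simp: myc_arcs_def)
      ultimately show "v \<in> (\<Union>i\<le>r. prj ` (F `` {Lev i u}))"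
        by (force intro!: bexI [of _ i])
    qed
    have "card (F' `` {u}) \<le> card (\<Union>i\<le>r. prj ` (F `` {Lev i u}))"
      using finF by (intro card_mono [OF _ sub]) (auto simp: finite_Image)
    also have "\<dots> \<le> (\<Sum>i\<le>r. card (prj ` (F `` {Lev i u})))"
      by (rule card_UN_le) simp
    also have "\<dots> \<le> (\<Sum>i\<le>r. M)"
      using finF out by (intro sum_mono order.trans [OF card_image_le]) (auto simp: finite_Image)
    finally show ?thesis using M'(1) by simp
  qed
  ultimately have "\<exists>\<phi> :: vertex \<Rightarrow> nat. (\<forall>x. \<phi> x < 3) \<and> (\<forall>u v. (u, v) \<in> F' \<longrightarrow> \<phi> u \<noteq> \<phi> v) \<and> (\<forall>a\<in>B. \<phi> a < 2)"
    using E finB cardB unfolding sparse_3colourable_def by meson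
  then obtain \<phi> :: "vertex \<Rightarrow> nat" where \<phi>: "\<And>x. \<phi> x < 3" "\<And>u v. (u, v) \<in> F' \<Longrightarrow> \<phi> u \<noteq> \<phi> v"
      "\<And>a. a \<in> B \<Longrightarrow> \<phi> a < 2"
    by blast

  define \<psi> where "\<psi> x = (if x \<in> P then lev x mod 2 else if x \<in> S then 2 else \<phi> (prj x))" for x
  have Apex_P: "Apex \<in> P" using l by (simp add: P_def T_def)
  have \<psi>_ne: "\<psi> x \<noteq> \<psi> y" if xy: "(x, y) \<in> F" for x y
  proof -
    have N: "y \<in> N x" "x \<in> N y" using N_F [OF xy] N_sym by auto
    have cons: "consecutive (lev x) (lev y)" by (rule N_lev [OF N(1)])
    consider "x \<in> P" "y \<in> P" | "x \<in> P" "y \<notin> P" | "x \<notin> P" "y \<in> P" | "x \<notin> P" "y \<notin> P" by blast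
    then show ?thesis
    proof cases
      case 1
      then have "lev x \<ge> l" "lev y \<ge> l" using lev_P by auto
      then have "odd (lev x + lev y)" using cons l by (auto simp: consecutive_def)
      then have "lev x mod 2 \<noteq> lev y mod 2" by presburger
      then show ?thesis using 1 by (simp add: \<psi>_def)
    next
      case 2
      then have "y \<in> S" using N by (auto simp: S_def)
      then show ?thesis using 2 by (simp add: \<psi>_def)
    next
      case 3
      then have "x \<in> S" using N by (auto simp: S_def)
      then show ?thesis using 3 by (simp add: \<psi>_def)
    next
      case 4
      have S_S: "\<not> (x \<in> S \<and> y \<in> S)"
        using lev_S(1) [of x] lev_S(2) [of x] lev_S(2) [of y] cons l by (auto simp: consecutive_def)
      have F': "(prj x, prj y) \<in> F'"
        using 4 Apex_P xy by (cases x; cases y) (auto simp: F'_def)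
      show ?thesis
        using 4 S_S \<phi>(2) [OF F'] \<phi>(3) [OF S_B [of x y]] \<phi>(3) [OF S_B [of y x]] N
        by (auto simp: \<psi>_def)
    qed
  qed
  show "\<exists>\<psi> :: vertex \<Rightarrow> nat. (\<forall>x. \<psi> x < 3) \<and> (\<forall>u v. (u, v) \<in> F \<longrightarrow> \<psi> u \<noteq> \<psi> v) \<and> (\<forall>a\<in>A. \<psi> a < 2)"
  proof (intro exI [of _ \<psi>] conjI allI ballI)
    fix x
    have "lev x mod 2 < 3" by presburger
    then show "\<psi> x < 3" using \<phi>(1) by (simp add: \<psi>_def)
  next
    fix x assume "x \<in> A"
    then show "\<psi> x < 2" using S_A [of x] \<phi>(3) [OF A_B] by (auto simp: \<psi>_def)
  qed (use \<psi>_ne in auto)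
qed


text \<open>
  Iterating the construction raises the dimension of the sphere, and hence the number of colours. The
  order of the quantifiers matters: the bound \<open>K\<close> on the indegrees depends only on \<open>n\<close>, whereas the
  digraph may depend on the bound \<open>M\<close> on the outdegrees of the subdigraphs to be coloured. The number
  of levels is larger the larger \<open>M\<close> is, and the digraph used below the new levels has to be good for
  a bound \<open>M'\<close> that is larger still.
\<close>

lemma sparsely_3colourable_digraph_exists:
  "\<exists>K. \<forall>M. \<exists>(V :: vertex set) E. finite V \<and> E \<subseteq> V \<times> V \<and>
     (\<exists>rank :: vertex \<Rightarrow> nat. \<forall>u v. (u, v) \<in> E \<longrightarrow> rank u < rank v) \<and>
     (\<forall>v. card (E\<inverse> `` {v}) \<le> K) \<and> sparse_3colourable M E \<and> has_sphere n V E"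
proof (induction n)
  case 0
  show ?case
    by (rule exI [of _ 0], rule allI, rule exI [of _ "{Apex}"], rule exI [of _ "{}"])
       (auto simp: has_sphere_point sparse_3colourable_def intro: exI [of _ "\<lambda>_. 0"])
next
  case (Suc n)
  then obtain K where K: "\<And>M. \<exists>(V :: vertex set) E. finite V \<and> E \<subseteq> V \<times> V \<and>
     (\<exists>rank :: vertex \<Rightarrow> nat. \<forall>u v. (u, v) \<in> E \<longrightarrow> rank u < rank v) \<and>
     (\<forall>v. card (E\<inverse> `` {v}) \<le> K) \<and> sparse_3colourable M E \<and> has_sphere n V E"
    by blast
  show ?case
  proof (rule exI [of _ "2 * K + 1"], rule allI)
    fix M :: nat
    define r where "r = 2 * M + 3"
    define M' where "M' = (r + 1) * M + (M + 1) * (M + 2 * K + 2) ^ 3"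
    from K [of M'] obtain V E and rank :: "vertex \<Rightarrow> nat" where V: "finite V" "E \<subseteq> V \<times> V"
      and rank: "\<And>u v. (u, v) \<in> E \<Longrightarrow> rank u < rank v"
      and E: "\<And>v. card (E\<inverse> `` {v}) \<le> K" "sparse_3colourable M' E" "has_sphere n V E"
      by blast
    have finE: "finite E" using V finite_subset by blast
    define rank' where "rank' x = (case x of Apex \<Rightarrow> 0 | Lev i u \<Rightarrow> Suc (rank u))" for x
    show "\<exists>(V :: vertex set) E. finite V \<and> E \<subseteq> V \<times> V \<and>
       (\<exists>rank :: vertex \<Rightarrow> nat. \<forall>u v. (u, v) \<in> E \<longrightarrow> rank u < rank v) \<and>
       (\<forall>v. card (E\<inverse> `` {v}) \<le> 2 * K + 1) \<and> sparse_3colourable M E \<and> has_sphere (Suc n) V E"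
    proof (intro exI conjI)
      show "finite (myc_verts r V)" using V by (simp add: finite_myc_verts)
      show "myc_arcs r V E \<subseteq> myc_verts r V \<times> myc_verts r V" using V by (simp add: myc_arcs_field)
      show "\<forall>u v. (u, v) \<in> myc_arcs r V E \<longrightarrow> rank' u < rank' v"
        using rank by (auto simp: myc_arcs_def rank'_def)
      show "\<forall>v. card ((myc_arcs r V E)\<inverse> `` {v}) \<le> 2 * K + 1"
        using myc_indegree [OF finE E(1)] by blast
      show "sparse_3colourable M (myc_arcs r V E)"
        by (rule sparse_3colourable_myc [OF finE E(1) _ _ _ E(2)]) (auto simp: r_def M'_def V)
      show "has_sphere (Suc n) (myc_verts r V) (myc_arcs r V E)"
        by (rule has_sphere_myc [OF E(3)]) (simp add: r_def)
    qed
  qed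
qed

section \<open>Arc graphs of acyclic digraphs\<close>

text \<open>
  The vertices of the arc graph are the arcs of the digraph, and two of them are adjacent if the head of
  one is the tail of the other. The map \<open>enc\<close> names arcs by natural numbers.
\<close>

definition arc_graph :: "('v \<times> 'v \<Rightarrow> nat) \<Rightarrow> 'v rel \<Rightarrow> nat pair_pre_digraph" where
  "arc_graph enc E = \<lparr> pverts = enc ` E,
     parcs = {(enc p, enc q) | p q. p \<in> E \<and> q \<in> E \<and> (snd p = fst q \<or> snd q = fst p)} \<rparr>"

locale encoded_acyclic =
  fixes E :: "'v rel" and enc :: "'v \<times> 'v \<Rightarrow> nat" and rank :: "'v \<Rightarrow> nat"
  assumes finE: "finite E" and enc: "inj_on enc E"
    and rank: "(u, v) \<in> E \<Longrightarrow> rank u < rank v"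
begin

abbreviation "G \<equiv> arc_graph enc E"

lemma rank': "p \<in> E \<Longrightarrow> rank (fst p) < rank (snd p)"
  using rank [of "fst p" "snd p"] by simp

lemma enc_eq: "p \<in> E \<Longrightarrow> q \<in> E \<Longrightarrow> enc p = enc q \<longleftrightarrow> p = q"
  using enc by (auto simp: inj_on_def)

lemma parcsE:
  assumes "(x, y) \<in> parcs G"
  obtains p q where "p \<in> E" "q \<in> E" "x = enc p" "y = enc q" "snd p = fst q \<or> snd q = fst p"
proof -
  from assms have "\<exists>p q. (x, y) = (enc p, enc q) \<and> p \<in> E \<and> q \<in> E \<and> (snd p = fst q \<or> snd q = fst p)"
    unfolding arc_graph_def pair_pre_digraph.simps mem_Collect_eq .
  then show ?thesis using that by (elim exE conjE Pair_inject)
qed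

lemma parcs_iff:
  assumes "p \<in> E" "q \<in> E"
  shows "(enc p, enc q) \<in> parcs G \<longleftrightarrow> snd p = fst q \<or> snd q = fst p"
proof
  assume "(enc p, enc q) \<in> parcs G"
  then show "snd p = fst q \<or> snd q = fst p"
    by (rule parcsE) (use assms enc_eq in metis)
next
  assume "snd p = fst q \<or> snd q = fst p"
  then show "(enc p, enc q) \<in> parcs G"
    using assms unfolding arc_graph_def pair_pre_digraph.simps mem_Collect_eq by blast
qed

lemma pair_graph: "pair_graph G"
proof
  have sub: "parcs G \<subseteq> pverts G \<times> pverts G"
    by (auto simp: arc_graph_def)
  show fin: "finite (pverts G)" using finE by (simp add: arc_graph_def)
  show "finite (parcs G)" using sub fin by (meson finite_SigmaI finite_subset)
  show "fst e \<in> pverts G" "snd e \<in> pverts G" if "e \<in> parcs G" for e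
    using sub that by auto
  show "fst e \<noteq> snd e" if e: "e \<in> parcs G" for e
  proof -
    obtain p q where "p \<in> E" "q \<in> E" "fst e = enc p" "snd e = enc q" "snd p = fst q \<or> snd q = fst p"
      using e parcsE [of "fst e" "snd e"] by (metis prod.collapse)
    then show ?thesis using rank' [of p] by (metis enc_eq less_irrefl)
  qed
  show "symmetric (with_proj G)"
    unfolding symmetric_def sym_def by (auto simp: arc_graph_def)
qed

lemma triangle_free: "triangle_free (with_proj G)"
  unfolding free_of_def
proof clarify
  fix L assume sub: "subgraph L (with_proj G)" and L: "complete_digraph 3 L"
  then obtain x y z where xyz: "verts L = {x, y, z}" "x \<noteq> y" "x \<noteq> z" "y \<noteq> z"
    by (auto simp: complete_digraph_def card_3_iff)
  have "arcs_ends L \<subseteq> parcs G"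
    using arcs_ends_mono [OF sub] by simp
  moreover have "(x, y) \<in> arcs_ends L" "(y, z) \<in> arcs_ends L" "(x, z) \<in> arcs_ends L"
    using L xyz by (auto simp: complete_digraph_def)
  ultimately have arcs: "(x, y) \<in> parcs G" "(y, z) \<in> parcs G" "(x, z) \<in> parcs G"
    by auto
  obtain p q where pq: "p \<in> E" "q \<in> E" "x = enc p" "y = enc q" 
    using arcs(1) by (rule parcsE)
  obtain r where r: "r \<in> E" "z = enc r"
    using arcs(2) by (rule parcsE)
  have "snd p = fst q \<or> snd q = fst p" "snd q = fst r \<or> snd r = fst q" "snd p = fst r \<or> snd r = fst p"
    using arcs pq r by (simp_all add: parcs_iff)
  then show False
    using rank' [OF pq(1)] rank' [OF pq(2)] rank' [OF r(1)] by (elim disjE) simp_all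
qed

text \<open>
  Given a colouring of the arc graph with \<open>k\<close> colours, colour each vertex \<open>u\<close> of the digraph with the
  set of the colours of the arcs out of \<open>u\<close>. For an arc from \<open>u\<close> to \<open>v\<close>, the colour of this arc is in
  the set of \<open>u\<close> but not in that of \<open>v\<close>. So \<open>2 ^ k\<close> colours suffice for the digraph.
\<close>

lemma chromatic_number:
  assumes "has_sphere (2 ^ k) V E"
  shows "chromatic_number (with_proj G) > k"
proof (rule ccontr)
  interpret G: pair_graph G by (rule pair_graph)
  assume "\<not> chromatic_number (with_proj G) > k"
  then have "colourable k (with_proj G)"
    using G.chromatic_number_le_iff by (simp add: not_less)
  then obtain c :: "nat \<Rightarrow> nat" where c: "c ` pverts G \<subseteq> {..<k}"
    and "\<forall>(x, y) \<in> parcs G. c x \<noteq> c y"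
    unfolding colourable_def with_proj_simps by blast
  then have proper: "\<And>x y. (x, y) \<in> parcs G \<Longrightarrow> c x \<noteq> c y"
    by blast
  define Out where "Out u = {c (enc (u, v)) | v. (u, v) \<in> E}" for u
  have Out: "Out u \<in> Pow {..<k}" for u
    using c by (auto simp: Out_def arc_graph_def)
  have ne: "Out u \<noteq> Out v" if "(u, v) \<in> E" for u v
  proof -
    have "c (enc (u, v)) \<in> Out u" using that by (auto simp: Out_def)
    moreover have "c (enc (u, v)) \<noteq> c (enc (v, w))" if "(v, w) \<in> E" for w
      using proper [of "enc (u, v)" "enc (v, w)"] that \<open>(u, v) \<in> E\<close> by (simp add: parcs_iff)
    then have "c (enc (u, v)) \<notin> Out v" by (auto simp: Out_def)
    ultimately show ?thesis by blast
  qed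
  obtain g :: "nat set \<Rightarrow> nat" where g: "bij_betw g (Pow {..<k}) {0..<card (Pow {..<k})}"
    using ex_bij_betw_finite_nat [of "Pow {..<k}"] by auto
  have "2 ^ k < (2 ^ k :: nat)"
  proof (rule has_sphere_colours [OF assms, of "\<lambda>u. g (Out u)"])
    show "(\<lambda>u. g (Out u)) ` V \<subseteq> {..<2 ^ k}"
      using bij_betwE [OF g] Out by (auto simp: card_Pow)
    show "g (Out u) \<noteq> g (Out v)" if "(u, v) \<in> E" for u v
      using ne [OF that] bij_betw_imp_inj_on [OF g] Out by (metis inj_onD)
  qed
  then show False by simp
qed

text \<open>
  Call an arc \<open>p\<close> heavy if, in \<open>H\<close>, it has at least \<open>t\<close> neighbours among the arcs that end in its tail
  \<open>b\<close>. There are at most \<open>K\<close> arcs into \<open>b\<close>, and each set of \<open>t\<close> of them has fewer than \<open>s\<close> common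
  neighbours in \<open>H\<close>. Hence the heavy arcs form a subdigraph \<open>F\<close> with small outdegrees, which has a
  3-colouring \<open>h\<close>.

  A heavy arc gets the colour under \<open>h\<close> of its tail. The other arcs are coloured greedily, in the order of
  their tails: such an arc \<open>p\<close> avoids the colour under \<open>h\<close> of its head and the colours of its fewer
  than \<open>t\<close> neighbours that end in its tail. So \<open>t + 1\<close> colours suffice. The colouring is proper, because
  no arc into \<open>b\<close> gets the colour of \<open>b\<close> under \<open>h\<close>, which is the colour of the heavy arcs out of \<open>b\<close>.
\<close>

lemma colourable_if_biclique_free:
  assumes K: "\<And>v. card (E\<inverse> `` {v}) \<le> K"
    and E: "sparse_3colourable ((s - 1) * 2 ^ K) E" and "t \<ge> 2" "s \<ge> 1"
    and H: "pair_graph H" "subgraph (with_proj H) (with_proj G)"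
    and free: "free_of (complete_bipartite_digraph s t) (with_proj H)"
  shows "colourable (t + 1) (with_proj H)"
proof -
  interpret H: pair_graph H by (rule H)
  have sub: "pverts H \<subseteq> pverts G" "parcs H \<subseteq> parcs G"
    using H(2) by (auto simp: subgraph_def)
  define preds where "preds p = {q \<in> E. snd q = fst p \<and> (enc q, enc p) \<in> parcs H}" for p
  define F where "F = {p \<in> E. card (preds p) \<ge> t}"
  have fin_preds: "finite (preds p)" for p
    using finE by (simp add: preds_def)

  have "card (F `` {b}) \<le> (s - 1) * 2 ^ K" for b
  proof -
    define In where "In = {q \<in> E. snd q = b}"
    have "In = (\<lambda>a. (a, b)) ` (E\<inverse> `` {b})" by (auto simp: In_def)
    then have "card In \<le> K"
      using K [of b] card_image_le [of "E\<inverse> `` {b}" "\<lambda>a. (a, b)"] finE by (simp add: finite_Image)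
    have "finite In" using finE by (simp add: In_def)
    have "\<exists>T. T \<subseteq> preds (b, c) \<and> card T = t" if "c \<in> F `` {b}" for c
    proof -
      have "t \<le> card (preds (b, c))" using that by (simp add: F_def)
      then show ?thesis by (metis obtain_subset_with_card_n)
    qed
    then obtain T where T: "\<And>c. c \<in> F `` {b} \<Longrightarrow> T c \<subseteq> preds (b, c) \<and> card (T c) = t"
      by metis
    define fibre where "fibre X = {c \<in> F `` {b}. T c = X}" for X
    have fin_fibre: "finite (fibre X)" for X
      using finE by (auto simp: fibre_def F_def intro!: finite_subset [of _ "E `` {b}"] finite_Image)
    \<comment> \<open>The \<open>s\<close> arcs out of \<open>b\<close> in a fibre of that size would form a \<open>K\<^bsub>s,t\<^esub>\<close> with \<open>X\<close>.\<close>
    have fibre: "card (fibre X) \<le> s - 1" for X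
    proof (rule ccontr)
      assume "\<not> card (fibre X) \<le> s - 1"
      then have "card (fibre X) \<ge> s" by simp
      then obtain U where U: "U \<subseteq> fibre X" "card U = s"
        using obtain_subset_with_card_n by metis
      then obtain c where "c \<in> U" using \<open>s \<ge> 1\<close> by fastforce
      have U_X: "(b, c) \<in> F" "X \<subseteq> preds (b, c)" "card X = t" if "c \<in> U" for c
      proof -
        have "c \<in> F `` {b}" "T c = X" using that U(1) unfolding fibre_def by blast+
        then show "(b, c) \<in> F" "X \<subseteq> preds (b, c)" "card X = t" using T [of c] by auto
      qed
      note X = U_X [OF \<open>c \<in> U\<close>]
      define L where "L = \<lparr> pverts = (\<lambda>c. enc (b, c)) ` U \<union> enc ` X,
        parcs = ((\<lambda>c. enc (b, c)) ` U) \<times> (enc ` X) \<union> (enc ` X) \<times> ((\<lambda>c. enc (b, c)) ` U) \<rparr>"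
      have arcs: "(enc q, enc (b, c)) \<in> parcs H" "snd q = b" if "c \<in> U" "q \<in> X" for c q
        using that(2) U_X(2) [OF that(1)] unfolding preds_def by auto
      have bE: "(b, c) \<in> E" if "c \<in> U" for c
        using U_X(1) [OF that] by (simp add: F_def)
      have XE: "X \<subseteq> E" using X by (auto simp: preds_def)
      have "complete_bipartite_digraph s t (with_proj L)"
        unfolding complete_bipartite_digraph_pair_def
      proof (intro conjI exI)
        show "pverts L = (\<lambda>c. enc (b, c)) ` U \<union> enc ` X"
          "parcs L = ((\<lambda>c. enc (b, c)) ` U) \<times> (enc ` X) \<union> (enc ` X) \<times> ((\<lambda>c. enc (b, c)) ` U)"
          by (simp_all add: L_def)
        show "finite (pverts L)"
          using finite_subset [OF U(1) fin_fibre] finite_subset [OF X(2) fin_preds] by (simp add: L_def)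
        show "(\<lambda>c. enc (b, c)) ` U \<inter> enc ` X = {}"
        proof -
          have False if cq: "c \<in> U" "q \<in> X" "enc (b, c) = enc q" for c q
          proof -
            have "(b, c) = q" using enc_eq [OF bE [OF cq(1)]] XE cq by blast
            then have "c = b" using arcs(2) [OF cq(1,2)] by auto
            then show False using rank [OF bE [OF cq(1)]] by simp
          qed
          then show ?thesis by blast
        qed
        have "inj_on (\<lambda>c. enc (b, c)) U"
          using bE by (auto simp: inj_on_def enc_eq)
        then show "card ((\<lambda>c. enc (b, c)) ` U) = s" using U by (simp add: card_image)
        show "card (enc ` X) = t" using X(3) XE enc by (metis card_image inj_on_subset)
      qed
      moreover have "subgraph (with_proj L) (with_proj H)"
        unfolding subgraph_def
      proof (intro conjI)
        have HL: "parcs L \<subseteq> parcs H"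
          using arcs(1) H.arcs_symmetric [OF arcs(1)] unfolding L_def by auto
        then show "arcs (with_proj L) \<subseteq> arcs (with_proj H)" by simp
        have "X \<noteq> {}" using X(3) \<open>t \<ge> 2\<close> by auto
        then obtain q where "q \<in> X" by blast
        then have "pverts L \<subseteq> pverts H"
          using H.in_arcsD1 [OF arcs(1) [OF \<open>c \<in> U\<close>]] H.in_arcsD2 [OF arcs(1) [OF _ \<open>q \<in> X\<close>]]
          unfolding L_def by auto
        then show "verts (with_proj L) \<subseteq> verts (with_proj H)" by simp
        show "wf_digraph (with_proj L)"
          by (auto simp: wf_digraph_wp_iff L_def pair_wf_digraph_def)
        show "wf_digraph (with_proj H)" by (rule H.wf_digraph)
      qed auto
      ultimately show False
        using free unfolding free_of_def by blast
    qed
    have "F `` {b} \<subseteq> (\<Union>X\<in>Pow In. fibre X)"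
    proof
      fix c assume c: "c \<in> F `` {b}"
      then have "T c \<in> Pow In" using T [OF c] by (auto simp: In_def preds_def)
      then show "c \<in> (\<Union>X\<in>Pow In. fibre X)" using c by (auto simp: fibre_def)
    qed
    then have "card (F `` {b}) \<le> card (\<Union>X\<in>Pow In. fibre X)"
      using \<open>finite In\<close> fin_fibre by (intro card_mono) auto
    also have "\<dots> \<le> (\<Sum>X\<in>Pow In. card (fibre X))"
      using \<open>finite In\<close> by (intro card_UN_le) simp
    also have "\<dots> \<le> card (Pow In) * (s - 1)"
      using sum_bounded_above [of "Pow In" "\<lambda>X. card (fibre X)", OF fibre] by simp
    also have "\<dots> \<le> 2 ^ K * (s - 1)"
      using \<open>card In \<le> K\<close> \<open>finite In\<close> by (intro mult_right_mono) (auto simp: card_Pow)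
    finally show ?thesis by (simp add: mult.commute)
  qed
  moreover have "F \<subseteq> E" by (auto simp: F_def)
  ultimately have "\<exists>h :: 'v \<Rightarrow> nat. (\<forall>x. h x < 3) \<and> (\<forall>u v. (u, v) \<in> F \<longrightarrow> h u \<noteq> h v) \<and> (\<forall>a\<in>{}. h a < 2)"
    using E unfolding sparse_3colourable_def by (metis card.empty finite.emptyI le0)
  then obtain h :: "'v \<Rightarrow> nat" where h: "\<And>x. h x < 3" "\<And>u v. (u, v) \<in> F \<Longrightarrow> h u \<noteq> h v"
    by blast

  define Q where "Q f p r \<longleftrightarrow> r < t + 1 \<and> (if p \<in> F then r = h (fst p) else r \<notin> insert (h (snd p)) (f ` preds p))"
    for f p and r :: nat
  have "\<exists>f. \<forall>p\<in>E. Q f p (f p)"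
  proof -
    have "\<exists>f. \<forall>p. p \<in> E \<longrightarrow> Q f p (f p)"
    proof (rule dependent_wf_choice [of "measure (\<lambda>p. rank (fst p))"])
      fix f g :: "'v \<times> 'v \<Rightarrow> nat" and p :: "'v \<times> 'v" and r :: nat
      assume "\<And>z. (z, p) \<in> measure (\<lambda>p. rank (fst p)) \<Longrightarrow> f z = g z"
      then have "f q = g q" if "q \<in> preds p" for q
        using that rank' [of q] by (auto simp: preds_def)
      then have "f ` preds p = g ` preds p" by (intro image_cong) auto
      then show "(p \<in> E \<longrightarrow> Q f p r) = (p \<in> E \<longrightarrow> Q g p r)" by (simp add: Q_def)
    next
      fix p :: "'v \<times> 'v" and f :: "'v \<times> 'v \<Rightarrow> nat"
      show "\<exists>r. p \<in> E \<longrightarrow> Q f p r"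
      proof (cases "p \<in> F")
        case True
        then show ?thesis using h(1) [of "fst p"] \<open>t \<ge> 2\<close> by (auto simp: Q_def)
      next
        case False
        show ?thesis
        proof (cases "p \<in> E")
          case True
          then have "card (preds p) < t" using False by (simp add: F_def)
          then have "card (insert (h (snd p)) (f ` preds p)) \<le> t"
            using card_image_le [OF fin_preds, of f p] fin_preds [of p] by (simp add: card_insert_if)
          then have "\<not> {..<t + 1} \<subseteq> insert (h (snd p)) (f ` preds p)"
            using card_mono [of "insert (h (snd p)) (f ` preds p)" "{..<t + 1}"] fin_preds [of p] by auto
          then show ?thesis using False unfolding Q_def by auto
        qed simp
      qed
    qed simp
    then show ?thesis by blast
  qed
  then obtain f where f: "\<And>p. p \<in> E \<Longrightarrow> Q f p (f p)" by blast
  have f_ne: "f q \<noteq> f p" if "q \<in> preds p" "p \<in> E" for p q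
  proof -
    have q: "q \<in> E" "snd q = fst p" using that by (auto simp: preds_def)
    have hq: "f q \<noteq> h (snd q)"
      using f [OF q(1)] h(2) [of "fst q" "snd q"] by (auto simp: Q_def split: if_splits)
    show ?thesis
    proof (cases "p \<in> F")
      case True
      then show ?thesis using f [OF that(2)] hq q by (simp add: Q_def)
    next
      case False
      then have "f p \<notin> f ` preds p" using f [OF that(2)] by (simp add: Q_def)
      then show ?thesis using that(1) by (metis imageI)
    qed
  qed
  define dec where "dec = inv_into E enc"
  have dec: "dec (enc p) = p" if "p \<in> E" for p
    using that enc by (simp add: dec_def)
  show ?thesis
    unfolding colourable_def
  proof (intro exI [of _ "\<lambda>x. f (dec x)"] conjI ballI)
    show "(\<lambda>x. f (dec x)) ` verts (with_proj H) \<subseteq> {..<t + 1}"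
      using sub(1) f by (auto simp: arc_graph_def dec Q_def)
    fix e assume e: "e \<in> arcs_ends (with_proj H)"
    obtain x y where xy: "e = (x, y)" by (cases e)
    with e have "(x, y) \<in> parcs H" by simp
    moreover from this have "(y, x) \<in> parcs H" by (rule H.arcs_symmetric)
    moreover obtain p q where "p \<in> E" "q \<in> E" "x = enc p" "y = enc q" "snd p = fst q \<or> snd q = fst p"
      using \<open>(x, y) \<in> parcs H\<close> sub(2) parcsE by (metis subsetD)
    ultimately have "f (dec x) \<noteq> f (dec y)"
      using f_ne [of p q] f_ne [of q p] by (auto simp: preds_def dec)
    then show "case e of (x, y) \<Rightarrow> f (dec x) \<noteq> f (dec y)" by (simp add: xy)
  qed
qed

end

theorem theorem1p5:
  fixes s t k :: nat
  assumes "s \<ge> t" and "t \<ge> 2" and "k \<ge> 1"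
  shows "\<exists>G :: nat pair_pre_digraph.
           pair_graph G \<and> triangle_free (with_proj G) \<and> chromatic_number (with_proj G) > k \<and>
           (\<forall>H :: nat pair_pre_digraph.
              pair_graph H \<and> subgraph (with_proj H) (with_proj G) \<and>
              free_of (complete_bipartite_digraph s t) (with_proj H) \<longrightarrow>
              colourable (t + 1) (with_proj H))"
proof -
  obtain K where "\<forall>M. \<exists>(V :: vertex set) E. finite V \<and> E \<subseteq> V \<times> V \<and>
     (\<exists>rank :: vertex \<Rightarrow> nat. \<forall>u v. (u, v) \<in> E \<longrightarrow> rank u < rank v) \<and>
     (\<forall>v. card (E\<inverse> `` {v}) \<le> K) \<and> sparse_3colourable M E \<and> has_sphere (2 ^ k) V E"
    using sparsely_3colourable_digraph_exists [of "2 ^ k"] by (elim exE)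
  from this [rule_format, of "(s - 1) * 2 ^ K"]
  obtain V :: "vertex set" and E and rank :: "vertex \<Rightarrow> nat" where V: "finite V" "E \<subseteq> V \<times> V"
    and rank: "\<forall>u v. (u, v) \<in> E \<longrightarrow> rank u < rank v"
    and indeg: "\<forall>v. card (E\<inverse> `` {v}) \<le> K"
    and E: "sparse_3colourable ((s - 1) * 2 ^ K) E" "has_sphere (2 ^ k) V E"
    by (elim exE conjE)
  have "finite E" using V finite_subset by blast
  from finite_imp_inj_to_nat_seg [OF this]
  obtain enc :: "vertex \<times> vertex \<Rightarrow> nat" where "inj_on enc E"
    by (elim exE conjE)
  then interpret encoded_acyclic E enc rank
    using \<open>finite E\<close> rank by unfold_locales auto
  show ?thesis
  proof (intro exI [of _ "arc_graph enc E"] conjI allI impI; (elim conjE)?)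
    fix H :: "nat pair_pre_digraph"
    assume "pair_graph H" "subgraph (with_proj H) (with_proj (arc_graph enc E))"
      "free_of (complete_bipartite_digraph s t) (with_proj H)"
    then show "colourable (t + 1) (with_proj H)"
      using colourable_if_biclique_free [OF indeg [rule_format] E(1), of t H] assms by linarith
  qed (rule pair_graph triangle_free chromatic_number [OF E(2)])+
qed

end
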